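(* Let $q$ be a power of a prime and let $\mathcal{H}$ be the Hermitian curve over $\mathbb{F}_{q^2}$. (i) For $q$ odd, the only possible planar intersections of $\mathcal{H}$ and a parabola are $\{0,1,q-1,q,q+1,2q-1,2q\}$. For each possible planar intersection, the exact number of parabolas sharing that value is: - value $0$: $q^2(q+1)\frac{q-1}{2}$ parabolas; - value $1$: $q^2(q+1)\frac{q(q-3)}{2}$ parabolas; - value $q-1$: $q^2(q+1)\frac{q(q-1)^2}{2}$ parabolas; - value $q$: $q^2(q+1)(q^2-q+1)$ parabolas; - value $q+1$: $q^2(q+1)\frac{q(q-1)(q-3)}{2}$ parabolas; - value $2q-1$: $q^2(q+1)\frac{q(q-1)}{2}$ parabolas; - value $2q$: $q^2(q+1)\frac{q-1}{2}$ parabolas. (ii) For $q$ even, the only possible planar intersections of $\mathcal{H}$ and a parabola are $\{1,q-1,q+1,2q-1\}$. For each possible planar intersection, the exact number of parabolas sharing that value is: - value $1$: $q^3(q+1)\left(\frac{q}{2}-1\right)$ parabolas; - value $q-1$: $q^3(q+1)(q-1)\frac{q}{2}$ parabolas; - value $q+1$: $q^3(q+1)(q-1)\left(\frac{q}{2}-1\right)$ parabolas; - value $2q-1$: $q^3(q+1)\frac{q}{2}$ parabolas.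
   Context: The Hermitian curve $\mathcal{H}$ is the plane curve over $\mathbb{F}_{q^2}$ with affine equation $x^{q+1}=y^q+y$, where $x,y\in\mathbb{F}_{q^2}$. A parabola is a curve $y=ax^2+bx+c$, where $x,y\in\mathbb{F}_{q^2}$ and $a,b,c\in\mathbb{F}_{q^2}$ are given with $a\neq 0$ (so there are $q^4(q^2-1)$ parabolas in total). The planar intersection of $\mathcal{H}$ and a parabola is the number of affine points $(x,y)\in\mathbb{F}_{q^2}^2$ that lie on both curves, disregarding multiplicity.
   Formalization: For q = 2 the listed values coincide (1 = q−1 and q+1 = 2q−1 = 3), so the table contradicts itself; there the number of parabolas with value 1 (and with value 3) is the sum of the two coinciding rows. *)

theory Defs
  imports Complex_Main "HOL-Library.Cardinality" "HOL-Number_Theory.Prime_Powers"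
    "HOL-Computational_Algebra.Polynomial"
begin

text \<open>
  The field with \<open>q\<^sup>2\<close> elements is an arbitrary type \<open>'a\<close> of class \<open>finite_field\<close> with
  \<open>CARD('a) = q\<^sup>2\<close>. Curves are represented by their sets of affine points over this field.
\<close>

definition hermitian_curve :: "nat \<Rightarrow> ('a::field \<times> 'a) set" where
  "hermitian_curve q = {(x, y). x ^ (q + 1) = y ^ q + y}"

definition parabola :: "'a::field \<Rightarrow> 'a \<Rightarrow> 'a \<Rightarrow> ('a \<times> 'a) set" where
  "parabola a b c = {(x, y). y = a * x ^ 2 + b * x + c}"

definition parabolas :: "('a::field \<times> 'a) set set" where
  "parabolas = {parabola a b c | a b c. a \<noteq> 0}"

definition planar_intersection :: "nat \<Rightarrow> ('a::field \<times> 'a) set \<Rightarrow> nat" where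
  "planar_intersection q C = card (hermitian_curve q \<inter> C)"

definition num_parabolas :: "'a::field itself \<Rightarrow> nat \<Rightarrow> nat \<Rightarrow> nat" where
  "num_parabolas _ q n = card {C \<in> (parabolas :: ('a \<times> 'a) set set). planar_intersection q C = n}"

text \<open>
  Counting parabolas as point sets is the same as counting coefficient triples \<open>(a, b, c)\<close>:
  over a field with more than two elements the point set determines the coefficients.
\<close>

lemma parabola_inject:
  fixes a b c a' b' c' :: "'a::finite_field"
  assumes "CARD('a) > 2" and eq: "parabola a b c = parabola a' b' c'"
  shows "a = a' \<and> b = b' \<and> c = c'"
proof -
  let ?p = "[:c - c', b - b', a - a':]"
  have "poly ?p x = 0" for x
  proof -
    have "(x, a * x ^ 2 + b * x + c) \<in> parabola a' b' c'"
      unfolding eq[symmetric] by (simp add: parabola_def)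
    then have "a * x ^ 2 + b * x + c = a' * x ^ 2 + b' * x + c'"
      by (simp add: parabola_def)
    then show ?thesis
      by (simp add: algebra_simps power2_eq_square)
  qed
  then have roots: "{x. poly ?p x = 0} = UNIV" by auto
  have "?p = 0"
  proof (rule ccontr)
    assume "?p \<noteq> 0"
    then have "card {x. poly ?p x = 0} \<le> degree ?p" by (rule card_poly_roots_bound)
    also have "\<dots> \<le> 2" by simp
    finally show False using assms(1) roots by simp
  qed
  then show ?thesis by simp
qed

lemma card_parabolas:
  assumes "CARD('a::finite_field) = q ^ 2" and "q \<ge> 2"
  shows "card (parabolas :: ('a \<times> 'a) set set) = q ^ 4 * (q ^ 2 - 1)"
proof -
  let ?T = "(UNIV - {0 :: 'a}) \<times> (UNIV :: 'a set) \<times> (UNIV :: 'a set)"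
  let ?f = "\<lambda>(a, b, c). parabola a b (c :: 'a)"
  have "q ^ 2 \<ge> 2 ^ 2" using assms(2) by (rule power_mono) simp
  then have "CARD('a) > 2" using assms(1) by simp
  then have "inj_on ?f ?T"
    by (auto simp: inj_on_def dest: parabola_inject)
  moreover have "parabolas = ?f ` ?T"
    by (force simp: parabolas_def)
  ultimately have "card (parabolas :: ('a \<times> 'a) set set) = card ?T"
    by (metis card_image)
  also have "\<dots> = (q ^ 2 - 1) * (q ^ 2 * q ^ 2)"
    by (simp add: card_cartesian_product card_Diff_singleton assms(1) del: UNIV_Times_UNIV)
  also have "\<dots> = q ^ 4 * (q ^ 2 - 1)"
    by (simp flip: power_add)
  finally show ?thesis .
qed

end

theory Submission
  imports Defs "HOL-Number_Theory.Residues"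
begin

text \<open>
  Write \<open>tr z = z\<^sup>q + z\<close> and let \<open>K\<close> be the fixed field of \<open>x \<mapsto> x\<^sup>q\<close>. The point of the parabola
  with abscissa \<open>x\<close> lies on the curve iff \<open>f(x) - tr (b x) = tr c\<close>, where
  \<open>f(x) = x\<^sup>q\<^sup>+\<^sup>1 - tr (a x\<^sup>2)\<close> is a \<open>K\<close>-quadratic form in two dimensions with polar form
  \<open>tr (g(x) y)\<close>, \<open>g(x) = x\<^sup>q - 2 a x\<close>.

  If \<open>4 a\<^sup>q\<^sup>+\<^sup>1 \<noteq> 1\<close>, then \<open>g\<close> is bijective, so a translation removes the linear term. The ratios
  \<open>x\<^sup>q\<^sup>-\<^sup>1\<close> of the nonzero zeros of \<open>f\<close> are the roots of norm 1 of a quadratic equation, of which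
  there are 0 or 2, so \<open>f\<close> has 1 or \<open>2q - 1\<close> zeros. The sizes of the other fibres of \<open>f\<close> then
  follow from their first two moments.

  If \<open>4 a\<^sup>q\<^sup>+\<^sup>1 = 1\<close>, then \<open>4 a f(x) = - g(x)\<^sup>2\<close> and \<open>g\<close> has a one-dimensional kernel. For \<open>b\<close> in
  the image of \<open>g\<close> the fibres can be read off from this square; for all other \<open>b\<close>, translation
  along the kernel shows that all fibres have the same size.
\<close>

section \<open>Counting by fibres and by roots of polynomials\<close>

lemma card_eq_sum_fibres:
  assumes "finite A" "finite B" "f ` A \<subseteq> B"
  shows "card A = (\<Sum>b\<in>B. card {x \<in> A. f x = b})"
  using sum.group[OF assms, of "\<lambda>_. 1 :: nat"] by simp

text \<open>The fibres add up to at most \<open>m * card B\<close>, hence to at most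
  \<open>m * n\<close>, which is already \<open>card A\<close>. There is no slack, so both bounds
  are attained. This turns root bounds into exact counts for the trace, the norm and the map
  \<open>x ^ (q - 1)\<close>.\<close>

lemma fibres_full:
  assumes "finite A" "finite B" "f ` A \<subseteq> B"
    and fib: "\<And>b. b \<in> B \<Longrightarrow> card {x \<in> A. f x = b} \<le> m"
    and B: "card B \<le> n" and A: "card A = m * n" and m: "m > 0"
  shows "card B = n" and "\<And>b. b \<in> B \<Longrightarrow> card {x \<in> A. f x = b} = m"
proof -
  have s: "m * n = (\<Sum>b\<in>B. card {x \<in> A. f x = b})"
    using card_eq_sum_fibres[OF assms(1-3)] A by simp
  also have "\<dots> \<le> (\<Sum>b\<in>B. m)" by (rule sum_mono) (rule fib)
  finally have "m * n \<le> m * card B" by (simp add: mult.commute)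
  with m B show cB: "card B = n" by simp
  show "card {x \<in> A. f x = b} = m" if "b \<in> B" for b
  proof (rule ccontr)
    assume "card {x \<in> A. f x = b} \<noteq> m"
    with fib[OF that] have "card {x \<in> A. f x = b} < m" by simp
    then have "(\<Sum>b\<in>B. card {x \<in> A. f x = b}) < (\<Sum>b\<in>B. m)"
      using that fib \<open>finite B\<close> by (intro sum_strict_mono_ex1) auto
    with s cB show False by (simp add: mult.commute)
  qed
qed

lemma card_pair_set:
  fixes P :: "'b::finite \<Rightarrow> 'c::finite \<Rightarrow> bool"
  shows "card {(x, y). P x y} = (\<Sum>x\<in>UNIV. card {y. P x y})"
proof -
  have "{(x, y). P x y} = (SIGMA x:UNIV. {y. P x y})" by auto
  then show ?thesis by simp
qed

text \<open>Each square counts the ordered pairs inside one fibre.\<close>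

lemma sum_square_fibres:
  fixes f :: "'b::finite \<Rightarrow> 'c"
  assumes "finite B" "range f \<subseteq> B"
  shows "(\<Sum>b\<in>B. card {x. f x = b} ^ 2) = card {(x, y). f x = f y}"
proof -
  have "card {(x, y). f x = f y} = (\<Sum>b\<in>B. card {z \<in> {(x, y). f x = f y}. f (fst z) = b})"
    by (rule card_eq_sum_fibres) (use assms in auto)
  also have "\<dots> = (\<Sum>b\<in>B. card ({x. f x = b} \<times> {x. f x = b}))"
    by (intro sum.cong refl arg_cong[where f = card]) auto
  finally show ?thesis by (simp add: card_cartesian_product power2_eq_square)
qed

text \<open>Indicators are added instead of separating cases, so the formula survives
  \<open>u = v\<close> and can later be summed over coefficients.\<close>

lemma card_constant_except_one:
  assumes "finite A" "t0 \<in> A" "h t0 = u" "\<And>t. t \<in> A \<Longrightarrow> t \<noteq> t0 \<Longrightarrow> h t = v"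
  shows "card {t \<in> A. h t = n} = of_bool (n = u) + (card A - 1) * of_bool (n = v)"
proof -
  have "{t \<in> A. h t = n} = (if n = u then {t0} else {}) \<union> (if n = v then A - {t0} else {})"
    using assms by auto
  moreover have "card A > 0" using assms by (auto simp: card_gt_0_iff)
  ultimately show ?thesis using assms by (auto simp: card_insert_if)
qed

lemma card_binomial_roots_le:
  fixes d c :: "'a::field"
  assumes "n \<ge> 2"
  shows "card {x. x ^ n + d * x = c} \<le> n"
proof -
  let ?p = "Polynomial.monom 1 n + [:- c, d:] :: 'a poly"
  have deg: "degree ?p = n"
    using assms degree_pCons_le[of "-c" "[:d:]"] by (subst degree_add_eq_left) (auto simp: degree_monom_eq)
  with assms have "?p \<noteq> 0" by auto
  then have "card {x. poly ?p x = 0} \<le> n" using card_poly_roots_bound[of ?p] deg by simp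
  moreover have "{x. poly ?p x = 0} = {x. x ^ n + d * x = c}"
    by (auto simp: poly_monom algebra_simps eq_neg_iff_add_eq_0)
  ultimately show ?thesis by simp
qed

section \<open>The field with \<open>q ^ 2\<close> elements: Frobenius, trace and norm\<close>

locale hermitian_field =
  fixes q :: nat and F :: "'a::finite_field itself"
  assumes primepow: "primepow q" and card_field: "CARD('a) = q ^ 2"
begin

lemma q_ge_2: "q \<ge> 2"
  using primepow_gt_Suc_0[OF primepow] by simp

text \<open>The characteristic is a prime dividing the field size, a power of the prime
  \<open>p\<close> below \<open>q\<close>, so it is \<open>p\<close>. Hence \<open>x ^ q\<close> is
  a power of the Frobenius map and additive.\<close>

lemma q_char: obtains n where "q = CHAR('a) ^ n" "n > 0"
proof -
  obtain p k where p: "prime p" "k > 0" "q = p ^ k" using primepow by (auto simp: primepow_def)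
  have "CHAR('a) dvd p ^ (2 * k)"
    using CHAR_dvd_CARD[where 'a = 'a] card_field p by (simp add: power_mult[symmetric] mult.commute)
  then have "CHAR('a) dvd p"
    using prime_dvd_power prime_CHAR_semidom[where 'a = 'a] by (metis CHAR_pos)
  then have "CHAR('a) = p"
    using p(1) prime_CHAR_semidom[where 'a = 'a] by (metis CHAR_pos primes_dvd_imp_eq)
  with p that show thesis by blast
qed

lemma frob_add: "(x + y :: 'a) ^ q = x ^ q + y ^ q"
proof -
  obtain n where "q = CHAR('a) ^ n" by (rule q_char)
  then show ?thesis
    using freshmans_dream'[where 'a = 'a and n = n] prime_CHAR_semidom[where 'a = 'a] by (metis CHAR_pos)
qed

lemma two_eq_0_iff: "(2 :: 'a) = 0 \<longleftrightarrow> even q"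
proof -
  obtain n where n: "q = CHAR('a) ^ n" "n > 0" by (rule q_char)
  have p: "prime CHAR('a)" using prime_CHAR_semidom[where 'a = 'a] by (metis CHAR_pos)
  have "(2 :: 'a) = 0 \<longleftrightarrow> CHAR('a) dvd 2" using of_nat_eq_0_iff_char_dvd[where 'a = 'a, of 2] by simp
  also have "\<dots> \<longleftrightarrow> CHAR('a) = 2" using p by (metis dvd_refl primes_dvd_imp_eq two_is_prime_nat)
  also have "\<dots> \<longleftrightarrow> even q" using n p by (auto simp: prime_nat_iff)
  finally show ?thesis .
qed

lemma frob_0 [simp]: "(0 :: 'a) ^ q = 0" using q_ge_2 by simp

lemma frob_minus: "(- x :: 'a) ^ q = - (x ^ q)"
  using frob_add[of x "- x"] by (simp add: eq_neg_iff_add_eq_0 add.commute)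

lemma frob_diff: "(x - y :: 'a) ^ q = x ^ q - y ^ q"
  using frob_add[of x "- y"] frob_minus[of y] by simp

lemma frob_two: "(2 :: 'a) ^ q = 2"
  using frob_add[of 1 1] by simp

lemma frob_frob [simp]: "((x :: 'a) ^ q) ^ q = x"
  using finite_field_power_card_eq_same[of x] card_field by (simp add: power2_eq_square power_mult)

lemma frob_eq_0_iff [simp]: "(x :: 'a) ^ q = 0 \<longleftrightarrow> x = 0"
  using q_ge_2 by simp

lemmas frob_simps = frob_add frob_diff frob_minus frob_two power_mult_distrib power_divide

definition K :: "'a set" where "K = {t. t ^ q = t}"

definition tr :: "'a \<Rightarrow> 'a" where "tr x = x ^ q + x"

lemma tr_add: "tr (x + y) = tr x + tr y" by (simp add: tr_def frob_simps)
lemma tr_minus: "tr (- x) = - tr x" by (simp add: tr_def frob_simps)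
lemma tr_0 [simp]: "tr 0 = 0" by (simp add: tr_def)
lemma tr_scale: "l \<in> K \<Longrightarrow> tr (l * x) = l * tr x"
  by (simp add: tr_def K_def frob_simps algebra_simps)
lemma tr_in_K: "tr x \<in> K" by (simp add: tr_def K_def frob_simps)

lemma K_0: "0 \<in> K" by (simp add: K_def)
lemma K_add: "s \<in> K \<Longrightarrow> t \<in> K \<Longrightarrow> s + t \<in> K" by (simp add: K_def frob_simps)
lemma K_diff: "s \<in> K \<Longrightarrow> t \<in> K \<Longrightarrow> s - t \<in> K" by (simp add: K_def frob_simps)
lemma K_divide: "s \<in> K \<Longrightarrow> t \<in> K \<Longrightarrow> s / t \<in> K" by (simp add: K_def frob_simps)
lemma norm_in_K: "(x :: 'a) ^ (q + 1) \<in> K" by (simp add: K_def frob_simps)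

lemma card_K_le: "card K \<le> q"
  using card_binomial_roots_le[OF q_ge_2, of "-1 :: 'a" 0] by (simp add: K_def)

lemma card_tr_fibre_le: "card {x. tr x = t} \<le> q"
  using card_binomial_roots_le[OF q_ge_2, of 1 t] by (simp add: tr_def)

text \<open>The trace distributes \<open>q ^ 2\<close> elements over \<open>K\<close>, while both
  \<open>K\<close> and every fibre have at most \<open>q\<close> elements by root counting;
  \<open>fibres_full\<close> gives equality.\<close>

lemma card_K: "card K = q" and card_tr_fibre: "t \<in> K \<Longrightarrow> card {x. tr x = t} = q"
  using fibres_full[of UNIV K tr q q] card_K_le card_tr_fibre_le tr_in_K card_field q_ge_2
  by (auto simp: power2_eq_square)

lemma card_K_nonzero: "card (K - {0}) = q - 1"
  using card_K K_0 by simp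

lemma card_units: "card (UNIV - {0 :: 'a}) = (q - 1) * (q + 1)"
proof -
  have "card (UNIV - {0 :: 'a}) = q * q - 1"
    by (simp add: card_Diff_singleton card_field power2_eq_square)
  then show ?thesis using q_ge_2 by (simp add: algebra_simps diff_mult_distrib)
qed

text \<open>The same argument, with the \<open>(q - 1) * (q + 1)\<close> units distributed over the
  \<open>q - 1\<close> nonzero elements of \<open>K\<close>.\<close>

lemma card_norm_fibre:
  assumes "t \<in> K" "t \<noteq> 0"
  shows "card {x. x ^ (q + 1) = t} = q + 1"
proof -
  have le: "card {x \<in> UNIV - {0}. x ^ (q + 1) = b} \<le> q + 1" for b :: 'a
    by (rule order_trans[OF card_mono card_binomial_roots_le[of "q + 1" 0 b]]) (use q_ge_2 in auto)
  have "card {x \<in> UNIV - {0}. x ^ (q + 1) = t} = q + 1"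
    using norm_in_K le assms card_K_nonzero card_units
    by (intro fibres_full(2)[of "UNIV - {0}" "K - {0}" "\<lambda>x. x ^ (q + 1)" "q + 1" "q - 1"])
      (auto simp: mult.commute)
  moreover have "{x \<in> UNIV - {0}. x ^ (q + 1) = t} = {x. x ^ (q + 1) = t}"
    using assms by auto
  ultimately show ?thesis by simp
qed

lemma norm_eq_1_power: "(x :: 'a) \<noteq> 0 \<Longrightarrow> (x ^ (q - 1)) ^ (q + 1) = 1"
proof -
  assume x: "x \<noteq> 0"
  have "x * (x ^ (q - 1)) ^ (q + 1) = x ^ (q ^ 2)"
    using q_ge_2 by (simp add: power_mult[symmetric] power_Suc[symmetric] power2_eq_square algebra_simps diff_mult_distrib
      del: power_Suc)
  then show ?thesis
    using x finite_field_power_card_eq_same[of x] card_field by simp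
qed

lemma power_q_eq: "(x :: 'a) ^ q = x * x ^ (q - 1)"
  using q_ge_2 by (simp flip: power_Suc)

text \<open>A third use of \<open>fibres_full\<close>: the units are mapped into the
  \<open>q + 1\<close> elements of norm 1.\<close>

lemma card_power_fibre:
  assumes "(u :: 'a) ^ (q + 1) = 1"
  shows "card {x. x \<noteq> 0 \<and> x ^ (q - 1) = u} = q - 1"
proof -
  have le: "card {x \<in> UNIV - {0}. x ^ (q - 1) = b} \<le> q - 1" for b :: 'a
  proof -
    \<comment> \<open>Multiplication by \<open>x\<close> gives an equation of degree
      \<open>q\<close>, so the root bound applies even for \<open>q = 2\<close>; discarding its root
      0 leaves \<open>q - 1\<close>.\<close>
    have "{x \<in> UNIV - {0}. x ^ (q - 1) = b} \<subseteq> {x. x ^ q + (- b) * x = 0} - {0}"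
      by (auto simp: power_q_eq)
    then have "card {x \<in> UNIV - {0}. x ^ (q - 1) = b} \<le> card ({x. x ^ q + (- b) * x = 0} - {0})"
      by (intro card_mono) auto
    also have "\<dots> = card {x. x ^ q + (- b) * x = 0} - 1" by (subst card_Diff_singleton) auto
    also have "\<dots> \<le> q - 1" using card_binomial_roots_le[OF q_ge_2, of "- b" 0] by simp
    finally show ?thesis .
  qed
  have "card {x \<in> UNIV - {0}. x ^ (q - 1) = u} = q - 1"
    using le assms card_units norm_eq_1_power q_ge_2 card_norm_fibre[of 1]
    by (intro fibres_full(2)[of "UNIV - {0}" "{u. u ^ (q + 1) = 1}" "\<lambda>x. x ^ (q - 1)" "q - 1" "q + 1"])
      (auto simp: K_def)
  then show ?thesis by simp
qed

section \<open>The quadratic form and its level sets\<close>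

definition qform :: "'a \<Rightarrow> 'a \<Rightarrow> 'a" where
  "qform a x = x ^ (q + 1) - tr (a * x ^ 2)"

text \<open>The map that represents the polar form of \<^term>\<open>qform a\<close> with respect to the trace pairing.\<close>

definition adj :: "'a \<Rightarrow> 'a \<Rightarrow> 'a" where
  "adj a x = x ^ q - 2 * a * x"

text \<open>The planar intersection at \<open>t = tr c\<close>: the coefficient \<open>c\<close>
  matters only through its trace.\<close>

definition level :: "'a \<Rightarrow> 'a \<Rightarrow> 'a \<Rightarrow> nat" where
  "level a b t = card {x. qform a x - tr (b * x) = t}"

text \<open>The condition for \<open>adj a\<close> to have a nonzero kernel, that is, for the polar
  form to be singular.\<close>

definition degenerate :: "'a \<Rightarrow> bool" where
  "degenerate a \<longleftrightarrow> 4 * a ^ (q + 1) = 1"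

lemma qform_0 [simp]: "qform a 0 = 0" by (simp add: qform_def)

lemma qform_in_K: "qform a x \<in> K"
  unfolding qform_def by (rule K_diff[OF norm_in_K tr_in_K])

lemma qform_add: "qform a (x + y) = qform a x + qform a y + tr (adj a x * y)"
  by (simp add: qform_def adj_def tr_def frob_simps power2_eq_square algebra_simps)

text \<open>The left side is the polar form, which inherits symmetry from
  \<open>x + y = y + x\<close>.\<close>

lemma tr_adj_sym: "tr (adj a x * y) = tr (adj a y * x)"
  using qform_add[of a x y] qform_add[of a y x] by (simp add: add.commute)

lemma adj_add: "adj a (x + y) = adj a x + adj a y"
  by (simp add: adj_def frob_simps algebra_simps)

lemma adj_diff: "adj a (x - y) = adj a x - adj a y"
  by (simp add: adj_def frob_simps algebra_simps)

lemma adj_minus: "adj a (- x) = - adj a x"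
  by (simp add: adj_def frob_simps algebra_simps)

lemma planar_intersection_parabola:
  "planar_intersection q (parabola a b c) = level a b (tr c)"
proof -
  have "hermitian_curve q \<inter> parabola a b c =
      (\<lambda>x. (x, a * x ^ 2 + b * x + c)) ` {x. qform a x - tr (b * x) = tr c}"
    by (auto simp: hermitian_curve_def parabola_def qform_def tr_def frob_simps algebra_simps)
  then show ?thesis
    by (simp add: planar_intersection_def level_def card_image inj_on_def)
qed

lemma card_linear_eq:
  assumes "(w :: 'a) \<noteq> 0" "s \<in> K"
  shows "card {x. tr (w * x) = s} = q"
proof -
  have "bij_betw (\<lambda>x. w * x) {x. tr (w * x) = s} {x. tr x = s}"
    by (rule bij_betwI[of _ _ _ "\<lambda>x. x / w"]) (use assms in auto)
  then show ?thesis using card_tr_fibre[OF assms(2)] by (simp add: bij_betw_same_card)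
qed

lemma adj_eq_0:
  assumes "adj a x = 0" "x \<noteq> 0"
  shows "degenerate a"
proof -
  have e: "x ^ q = 2 * a * x" using assms by (simp add: adj_def)
  \<comment> \<open>Apply the Frobenius map to \<open>e\<close>, then substitute \<open>e\<close>
    once more.\<close>
  have "x = (2 * a * x) ^ q" using frob_frob[of x] e by simp
  also have "\<dots> = 2 * a ^ q * x ^ q" by (simp add: frob_simps)
  also have "\<dots> = 4 * a ^ (q + 1) * x" by (simp add: e)
  finally show ?thesis using assms by (simp add: degenerate_def)
qed

lemma sum_level: "(\<Sum>t\<in>K. level a b t) = q ^ 2"
proof -
  have "(\<lambda>x. qform a x - tr (b * x)) ` UNIV \<subseteq> K" using K_diff qform_in_K tr_in_K by auto
  from card_eq_sum_fibres[OF _ _ this] show ?thesis by (simp add: level_def card_field)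
qed

text \<open>Completing the square: the cross term \<open>tr (adj a x0 * x)\<close> of
  \<open>qform a (x + x0)\<close> is \<open>- tr (b * x)\<close>.\<close>

lemma level_shift:
  assumes "adj a x0 = - b"
  shows "level a b t = level a 0 (t + qform a x0)"
proof -
  have e: "qform a x - tr (b * x) = qform a (x + x0) - qform a x0" for x
    by (simp add: qform_add tr_adj_sym[of a x x0] assms tr_minus)
  have "bij_betw (\<lambda>x. x + x0) {x. qform a x - tr (b * x) = t} {x. qform a x = t + qform a x0}"
    by (rule bij_betwI[of _ _ _ "\<lambda>x. x - x0"]) (auto simp: e diff_eq_eq)
  then show ?thesis by (simp add: level_def bij_betw_same_card)
qed

text \<open>The shift in \<open>level_shift\<close> lies in \<open>K\<close>, so it permutes
  \<open>K\<close> and merely relabels the levels.\<close>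

lemma card_level_shift:
  assumes "b \<in> range (adj a)"
  shows "card {t \<in> K. level a b t = n} = card {t \<in> K. level a 0 t = n}"
proof -
  obtain x where "b = adj a x" using assms by auto
  then have x: "adj a (- x) = - b" by (simp add: adj_minus)
  have "bij_betw (\<lambda>t. t + qform a (- x)) {t \<in> K. level a b t = n} {t \<in> K. level a 0 t = n}"
    by (rule bij_betwI[of _ _ _ "\<lambda>t. t - qform a (- x)"])
      (auto simp: level_shift[OF x] intro: K_add K_diff qform_in_K)
  then show ?thesis by (rule bij_betw_same_card)
qed


section \<open>The nondegenerate case\<close>

lemma adj_bij:
  assumes "\<not> degenerate a"
  shows "bij (adj a)"
proof -
  have "inj (adj a)"
  proof (rule injI)
    fix x y assume "adj a x = adj a y"
    then have "adj a (x - y) = 0" by (simp add: adj_diff)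
    with adj_eq_0 assms show "x = y" by fastforce
  qed
  then show ?thesis by (simp add: bij_def finite_UNIV_inj_surj)
qed

text \<open>The second moment counts pairs of points with equal value, sorted here by their
  difference \<open>z\<close>. For \<open>z = 0\<close> all \<open>q ^ 2\<close> points qualify; for
  every other \<open>z\<close> the condition is a nontrivial trace equation in \<open>x\<close> with
  \<open>q\<close> solutions.\<close>

lemma sum_level_square:
  assumes "\<not> degenerate a"
  shows "(\<Sum>t\<in>K. level a 0 t ^ 2) = q ^ 2 + (q ^ 2 - 1) * q"
proof -
  have "(\<Sum>t\<in>K. level a 0 t ^ 2) = card {(z, x). qform a x = qform a z}"
    using sum_square_fibres[of K "qform a"] qform_in_K by (auto simp: level_def eq_commute)
  also have "\<dots> = card {(z, x). qform a (x + z) = qform a x}"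
  proof (rule bij_betw_same_card)
    show "bij_betw (\<lambda>(z, x). (z - x, x)) {(z, x). qform a x = qform a z}
        {(z, x). qform a (x + z) = qform a x}"
      by (rule bij_betwI[of _ _ _ "\<lambda>(z, x). (z + x, x)"]) (auto simp: add.commute)
  qed
  also have "\<dots> = (\<Sum>z\<in>UNIV. card {x. qform a (x + z) = qform a x})"
    by (rule card_pair_set)
  also have "\<dots> = card {x. qform a (x + 0) = qform a x} +
      (\<Sum>z\<in>UNIV - {0}. card {x. qform a (x + z) = qform a x})"
    by (rule sum.remove) auto
  also have "(\<Sum>z\<in>UNIV - {0}. card {x. qform a (x + z) = qform a x}) = (\<Sum>z\<in>UNIV - {0 :: 'a}. q)"
  proof (rule sum.cong[OF refl])
    fix z :: 'a assume "z \<in> UNIV - {0}"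
    then have nz: "adj a z \<noteq> 0" using adj_eq_0 assms by auto
    have "{x. qform a (x + z) = qform a x} = {x. tr (adj a z * x) = - qform a z}"
      by (auto simp: qform_add tr_adj_sym[of a _ z] eq_neg_iff_add_eq_0 add.commute)
    then show "card {x. qform a (x + z) = qform a x} = q"
      using card_linear_eq[OF nz, of "- qform a z"] K_diff[OF K_0 qform_in_K[of a z]] by simp
  qed
  finally show ?thesis by (simp add: card_field card_Diff_singleton)
qed

text \<open>The nonzero zeros are the \<open>x\<close> with \<open>x ^ (q - 1)\<close> in
  \<open>R\<close>, and each element of \<open>R\<close> accounts for \<open>q - 1\<close> of them.
  If one root of the quadratic has norm 1, so does the other, and nondegeneracy keeps them distinct;
  so \<open>R\<close> has 0 or 2 elements.\<close>

lemma level_zero_cases: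
  assumes nd: "\<not> degenerate a" and a: "a \<noteq> 0"
  shows "level a 0 0 = 1 \<or> level a 0 0 = 2 * q - 1"
proof -
  define R where "R = {u. u ^ (q + 1) = 1 \<and> a ^ q * u ^ 2 - u + a = 0}"
  have fac: "qform a x = - (x ^ 2) * (a ^ q * (x ^ (q - 1)) ^ 2 - x ^ (q - 1) + a)" for x
    using power_q_eq[of x]
    by (simp add: qform_def tr_def frob_simps power2_eq_square algebra_simps)
  have Z: "{x. x \<noteq> 0 \<and> qform a x = 0} = {x. x \<noteq> 0 \<and> x ^ (q - 1) \<in> R}"
    using norm_eq_1_power by (auto simp: fac R_def)
  have "card {x. x \<noteq> 0 \<and> x ^ (q - 1) \<in> R} =
      (\<Sum>u\<in>R. card {x \<in> {x. x \<noteq> 0 \<and> x ^ (q - 1) \<in> R}. x ^ (q - 1) = u})"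
    by (rule card_eq_sum_fibres) auto
  also have "\<dots> = (\<Sum>u\<in>R. q - 1)"
  proof (rule sum.cong[OF refl])
    fix u assume "u \<in> R"
    then have "{x \<in> {x. x \<noteq> 0 \<and> x ^ (q - 1) \<in> R}. x ^ (q - 1) = u} = {x. x \<noteq> 0 \<and> x ^ (q - 1) = u}"
      and "u ^ (q + 1) = 1" by (auto simp: R_def)
    then show "card {x \<in> {x. x \<noteq> 0 \<and> x ^ (q - 1) \<in> R}. x ^ (q - 1) = u} = q - 1"
      using card_power_fibre[of u] by simp
  qed
  finally have c: "card {x. x \<noteq> 0 \<and> qform a x = 0} = card R * (q - 1)"
    using Z by simp
  have "{x. qform a x = 0} = insert 0 {x. x \<noteq> 0 \<and> qform a x = 0}" by auto
  then have l: "level a 0 0 = 1 + card R * (q - 1)" using c by (simp add: level_def)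
  have "card R = 0 \<or> card R = 2"
  proof (cases "R = {}")
    case False
    then obtain u where u: "u ^ (q + 1) = 1" "a ^ q * u ^ 2 - u + a = 0" by (auto simp: R_def)
    \<comment> \<open>The other root by Vieta: the sum of the roots is
      \<open>1 / a ^ q\<close>.\<close>
    define v where "v = 1 / a ^ q - u"
    have aq: "a ^ q \<noteq> 0" using a by simp
    have u0: "u \<noteq> 0" using u q_ge_2 by auto
    have uq: "u ^ q = 1 / u" using u u0 by (simp add: field_simps)
    have sumuv: "a ^ q * (u + v) = 1" using aq by (simp add: v_def field_simps)
    have av: "a ^ q * v = 1 - a ^ q * u" using sumuv by (simp add: algebra_simps)
    have "a ^ q * v ^ 2 - v + a = v * (a ^ q * v) - v + a" by (simp add: power2_eq_square)
    also have "\<dots> = - (u * (a ^ q * v)) + a" by (subst av) (simp add: algebra_simps)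
    also have "\<dots> = a ^ q * u ^ 2 - u + a" by (subst av) (simp add: algebra_simps power2_eq_square)
    finally have rv: "a ^ q * v ^ 2 - v + a = 0" using u by simp
    have uv: "a ^ q * (u * v) = a"
    proof -
      have "a ^ q * (u * v) = u * (a ^ q * v)" by simp
      also have "\<dots> = a - (a ^ q * u ^ 2 - u + a)" unfolding av by (simp add: power2_eq_square algebra_simps)
      finally show ?thesis using u by simp
    qed
    \<comment> \<open>Multiplying the product relation \<open>uv\<close> by its conjugate shows that
      \<open>u * v\<close> has norm 1.\<close>
    have "a * (u ^ q * v ^ q) = a ^ q"
      using arg_cong[OF uv, of "\<lambda>z. z ^ q"] by (simp add: frob_simps)
    then have "a * (a ^ q * (u * v) * (u ^ q * v ^ q)) = a * a ^ q * 1"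
      unfolding uv by (simp add: ac_simps)
    then have "a * (a ^ q) * (u ^ (q + 1) * v ^ (q + 1)) = a * a ^ q * 1" by (simp add: ac_simps)
    then have nv: "v ^ (q + 1) = 1" using a aq u by simp
    have "v \<noteq> u"
    proof
      \<comment> \<open>A double root gives \<open>2 * u * a ^ q = 1\<close>; the product with its
        conjugate is the degeneracy condition.\<close>
      assume "v = u"
      then have e: "2 * u * a ^ q = 1" using sumuv by (simp add: algebra_simps)
      have e': "2 * u ^ q * a = 1" using arg_cong[OF e, of "\<lambda>z. z ^ q"] by (simp add: frob_simps)
      have "4 * u ^ (q + 1) * a ^ (q + 1) = (2 * u * a ^ q) * (2 * u ^ q * a)" by simp
      then have "4 * a ^ (q + 1) = 1" unfolding e e' u(1) by simp
      with nd show False by (simp add: degenerate_def)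
    qed
    moreover have "R = {u, v}"
    proof -
      have "w = u \<or> w = v" if "a ^ q * w ^ 2 - w + a = 0" for w
      proof -
        have "(w - u) * (a ^ q * (w + u) - 1) = (a ^ q * w ^ 2 - w + a) - (a ^ q * u ^ 2 - u + a)"
          by (simp add: algebra_simps power2_eq_square)
        then have "w = u \<or> a ^ q * (w + u) = a ^ q * (u + v)" using that u sumuv by simp
        then show ?thesis using aq by (metis add.commute add_left_cancel mult_left_cancel)
      qed
      then show ?thesis using u rv nv by (auto simp: R_def)
    qed
    ultimately show ?thesis by simp
  qed simp
  then show ?thesis using l q_ge_2 by auto
qed

text \<open>Expands the square and inserts \<open>sum_level\<close> and
  \<open>sum_level_square\<close>, each with its term at \<open>t = 0\<close> split off.\<close>

lemma sum_square_deviation: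
  fixes c :: int
  assumes "\<not> degenerate a"
  shows "(\<Sum>t\<in>K - {0}. (int (level a 0 t) - c) ^ 2) =
    int q ^ 3 + int q ^ 2 - int q - int (level a 0 0) ^ 2
      - 2 * c * (int q ^ 2 - int (level a 0 0)) + (int q - 1) * c ^ 2"
proof -
  let ?l = "\<lambda>t. int (level a 0 t)"
  have s1: "(\<Sum>t\<in>K - {0}. ?l t) = int q ^ 2 - ?l 0"
    using arg_cong[OF sum_level[of a 0], of int] K_0 by (simp add: sum.remove[of K 0])
  have "int (q ^ 2 + (q ^ 2 - 1) * q) = int q ^ 3 + int q ^ 2 - int q"
  proof -
    have "q ^ 2 - 1 + 1 = q ^ 2" using q_ge_2 by simp
    then have "int (q ^ 2 - 1) = int q ^ 2 - 1" by (metis add_diff_cancel_right' of_nat_1 of_nat_add of_nat_power)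
    then show ?thesis by (simp add: left_diff_distrib power3_eq_cube power2_eq_square)
  qed
  then have s2: "(\<Sum>t\<in>K - {0}. ?l t ^ 2) = int q ^ 3 + int q ^ 2 - int q - ?l 0 ^ 2"
    using arg_cong[OF sum_level_square[OF assms], of int] K_0 by (simp add: sum.remove[of K 0])
  have s0: "(\<Sum>t\<in>K - {0}. c ^ 2) = (int q - 1) * c ^ 2"
    using card_K_nonzero q_ge_2 by (simp add: of_nat_diff)
  have "(\<Sum>t\<in>K - {0}. (?l t - c) ^ 2) =
      (\<Sum>t\<in>K - {0}. ?l t ^ 2) - 2 * c * (\<Sum>t\<in>K - {0}. ?l t) + (\<Sum>t\<in>K - {0}. c ^ 2)"
    by (simp add: power2_diff sum.distrib sum_subtractf sum_distrib_left algebra_simps)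
  then show ?thesis unfolding s0 s1 s2 .
qed

text \<open>The hypothesis makes the sum of the squared deviations from \<open>c\<close> vanish.\<close>

lemma level_const:
  fixes c :: nat
  assumes "\<not> degenerate a" and t: "t \<in> K" "t \<noteq> 0"
    and "int q ^ 3 + int q ^ 2 - int q - int (level a 0 0) ^ 2
      - 2 * int c * (int q ^ 2 - int (level a 0 0)) + (int q - 1) * int c ^ 2 = 0"
  shows "level a 0 t = c"
proof -
  have "(\<Sum>t\<in>K - {0}. (int (level a 0 t) - int c) ^ 2) = 0"
    using sum_square_deviation[OF assms(1), of "int c"] assms(4) by simp
  then have "\<forall>t\<in>K - {0}. (int (level a 0 t) - int c) ^ 2 = 0"
    by (subst (asm) sum_nonneg_eq_0_iff) auto
  with t show ?thesis by simp
qed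

text \<open>The constant is the mean \<open>(q ^ 2 - 1) / (q - 1)\<close> of the remaining levels,
  and their variance comes out as zero.\<close>

lemma level_elliptic:
  assumes "\<not> degenerate a" "level a 0 0 = 1" "t \<in> K" "t \<noteq> 0"
  shows "level a 0 t = q + 1"
  using assms by (intro level_const) (auto simp: algebra_simps power2_eq_square power3_eq_cube)

text \<open>Here the mean is \<open>(q ^ 2 - (2 * q - 1)) / (q - 1)\<close>, again with variance
  zero.\<close>

lemma level_hyperbolic:
  assumes "\<not> degenerate a" "level a 0 0 = 2 * q - 1" "t \<in> K" "t \<noteq> 0"
  shows "level a 0 t = q - 1"
  using assms q_ge_2 by (intro level_const) (auto simp: algebra_simps power2_eq_square power3_eq_cube of_nat_diff)

lemma card_level_elliptic:
  assumes "\<not> degenerate a" "level a 0 0 = 1"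
  shows "card {t \<in> K. level a b t = n} = of_bool (n = 1) + (q - 1) * of_bool (n = q + 1)"
proof -
  have "b \<in> range (adj a)" using adj_bij[OF assms(1)] by (simp add: bij_def)
  from card_level_shift[OF this, of n] show ?thesis
    using card_constant_except_one[of K 0 "level a 0" 1 "q + 1" n] level_elliptic[OF assms] assms K_0 card_K
    by simp
qed

lemma card_level_hyperbolic:
  assumes "\<not> degenerate a" "level a 0 0 = 2 * q - 1"
  shows "card {t \<in> K. level a b t = n} = of_bool (n = 2 * q - 1) + (q - 1) * of_bool (n = q - 1)"
proof -
  have "b \<in> range (adj a)" using adj_bij[OF assms(1)] by (simp add: bij_def)
  from card_level_shift[OF this, of n] show ?thesis
    using card_constant_except_one[of K 0 "level a 0" "2 * q - 1" "q - 1" n] level_hyperbolic[OF assms] assms K_0 card_K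
    by simp
qed


section \<open>The degenerate case\<close>

context
  fixes a :: 'a
  assumes deg: "degenerate a"
begin

lemma degenerate_nonzero: "a \<noteq> 0" "(2 :: 'a) \<noteq> 0"
proof -
  have d: "2 * 2 * a ^ (q + 1) = 1" using deg by (simp add: degenerate_def)
  then show "a \<noteq> 0" by auto
  show "(2 :: 'a) \<noteq> 0"
  proof
    assume "(2 :: 'a) = 0"
    with d show False by (metis mult_zero_left zero_neq_one)
  qed
qed

lemma four_neq_0: "(4 :: 'a) \<noteq> 0"
proof -
  have "(2 :: 'a) * 2 \<noteq> 0" using degenerate_nonzero by (metis mult_eq_0_iff)
  then show ?thesis by simp
qed

lemma qform_eq_square: "4 * a * qform a x = - (adj a x ^ 2)"
proof -
  \<comment> \<open>The relation \<open>4 * a ^ (q + 1) = 1\<close>, in the shape in which it occurs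
    in the expanded product.\<close>
  have d: "a * (a ^ q * (z * 4)) = z" for z
    using arg_cong[OF deg[unfolded degenerate_def], of "\<lambda>w. w * z"] by (simp add: algebra_simps)
  show ?thesis
    by (simp add: qform_def adj_def tr_def frob_simps power2_eq_square algebra_simps d)
qed

lemma qform_eq_iff: "qform a x = qform a y \<longleftrightarrow> adj a x = adj a y \<or> adj a x = - adj a y"
proof -
  have "qform a x = qform a y \<longleftrightarrow> 4 * a * qform a x = 4 * a * qform a y"
    using degenerate_nonzero four_neq_0 by simp
  also have "\<dots> \<longleftrightarrow> adj a x ^ 2 = adj a y ^ 2" by (simp only: qform_eq_square) simp
  finally show ?thesis by (simp add: power2_eq_iff)
qed

text \<open>A nonzero \<open>x\<close> lies in the kernel iff \<open>x ^ (q - 1) = 2 * a\<close>,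
  and \<open>2 * a\<close> has norm 1 by degeneracy.\<close>

lemma card_kernel: "card {x. adj a x = 0} = q"
proof -
  have "(2 * a) ^ (q + 1) = 1" using deg by (simp add: degenerate_def frob_simps algebra_simps)
  then have c: "card {x. x \<noteq> 0 \<and> x ^ (q - 1) = 2 * a} = q - 1" by (rule card_power_fibre)
  have "{x. adj a x = 0} = insert 0 {x. x \<noteq> 0 \<and> x ^ (q - 1) = 2 * a}"
    by (auto simp: adj_def power_q_eq)
  then have "card {x. adj a x = 0} = Suc (card {x. x \<noteq> 0 \<and> x ^ (q - 1) = 2 * a})" by simp
  with c q_ge_2 show ?thesis by simp
qed

lemma card_adj_fibre: "card {x. adj a x = adj a y} = q"
proof -
  have "bij_betw (\<lambda>x. x - y) {x. adj a x = adj a y} {x. adj a x = 0}"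
    by (rule bij_betwI[of _ _ _ "\<lambda>x. x + y"]) (auto simp: adj_diff adj_add)
  then show ?thesis using card_kernel by (simp add: bij_betw_same_card)
qed

lemma card_range_adj: "card (range (adj a)) = q"
proof -
  have "q ^ 2 = (\<Sum>s\<in>range (adj a). card {x \<in> UNIV. adj a x = s})"
    unfolding card_field[symmetric] by (rule card_eq_sum_fibres) auto
  also have "\<dots> = (\<Sum>s\<in>range (adj a). q)"
    by (rule sum.cong) (auto simp: card_adj_fibre)
  finally show ?thesis using q_ge_2 by (simp add: power2_eq_square)
qed

text \<open>Symmetry of the polar form makes the image orthogonal to the kernel, and both sides have
  \<open>q\<close> elements.\<close>

lemma range_adj:
  assumes "adj a k = 0" "k \<noteq> 0"
  shows "range (adj a) = {b. tr (k * b) = 0}"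
proof (rule card_subset_eq)
  show "range (adj a) \<subseteq> {b. tr (k * b) = 0}"
    using tr_adj_sym[of a _ k] assms by (auto simp: mult.commute)
  show "card (range (adj a)) = card {b. tr (k * b) = 0}"
    using card_linear_eq[OF assms(2) K_0] card_range_adj by simp
qed simp

lemma level_degenerate_zero: "level a 0 0 = q"
  using qform_eq_iff[of _ 0] card_kernel by (simp add: level_def adj_def)

text \<open>A nonempty fibre of \<open>qform a\<close> over \<open>t\<close> consists of two fibres
  of \<open>adj a\<close>, over opposite values. These differ because \<open>2 \<noteq> 0\<close>,
  and each has \<open>q\<close> elements.\<close>

lemma level_degenerate_nonzero:
  assumes "t \<noteq> 0"
  shows "level a 0 t = 0 \<or> level a 0 t = 2 * q"
proof (cases "\<exists>y. qform a y = t")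
  case True
  then obtain y where y: "qform a y = t" by blast
  have "adj a y \<noteq> 0" using qform_eq_iff[of y 0] y assms by (auto simp: adj_def)
  then have ne: "adj a y \<noteq> adj a (- y)"
    using degenerate_nonzero by (simp add: adj_minus eq_neg_iff_add_eq_0 flip: mult_2)
  have "{x. qform a x = t} = {x. adj a x = adj a y} \<union> {x. adj a x = adj a (- y)}"
    using qform_eq_iff[of _ y] y by (auto simp: adj_minus)
  moreover have "{x. adj a x = adj a y} \<inter> {x. adj a x = adj a (- y)} = {}" using ne by auto
  ultimately have "card {x. qform a x = t} = q + q"
    using card_adj_fibre by (simp add: card_Un_disjoint)
  then show ?thesis by (simp add: level_def)
qed (simp add: level_def)

text \<open>After reduction to \<open>b = 0\<close>, the total \<open>q ^ 2\<close> of all levels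
  forces exactly half of the nonzero elements of \<open>K\<close> to have level
  \<open>2 * q\<close>. The factor 2 avoids halving \<open>q - 1\<close>.\<close>

lemma card_level_degenerate_range:
  assumes "b \<in> range (adj a)"
  shows "2 * card {t \<in> K. level a b t = n} =
    2 * of_bool (n = q) + (q - 1) * (of_bool (n = 0) + of_bool (n = 2 * q))"
proof -
  let ?A = "{t \<in> K - {0}. level a 0 t = 2 * q}" and ?B = "{t \<in> K - {0}. level a 0 t = 0}"
  have "q ^ 2 = (\<Sum>t\<in>K. level a 0 t)" by (rule sum_level[symmetric])
  also have "\<dots> = q + (\<Sum>t\<in>K - {0}. level a 0 t)"
    using K_0 by (simp add: sum.remove[of K 0] level_degenerate_zero)
  also have "(\<Sum>t\<in>K - {0}. level a 0 t) = (\<Sum>t\<in>?A. level a 0 t)"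
  proof (rule sum.mono_neutral_right)
    show "\<forall>t\<in>K - {0} - ?A. level a 0 t = 0" using level_degenerate_nonzero by fastforce
  qed auto
  also have "\<dots> = (\<Sum>t\<in>?A. 2 * q)" by (rule sum.cong) auto
  finally have "q * (1 + 2 * card ?A) = q * q" by (simp add: power2_eq_square algebra_simps)
  then have A: "1 + 2 * card ?A = q" using q_ge_2 by (simp only: mult_cancel1) auto
  have "card (?A \<union> ?B) = card ?A + card ?B"
    using q_ge_2 by (intro card_Un_disjoint) auto
  moreover have "?A \<union> ?B = K - {0}" using level_degenerate_nonzero by fastforce
  ultimately have B: "card ?A + card ?B = q - 1" using card_K_nonzero by simp
  have v: "if t = 0 then level a 0 t = q else level a 0 t = 0 \<or> level a 0 t = 2 * q" for t
    using level_degenerate_zero level_degenerate_nonzero[of t] by simp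
  have "level a 0 t = q \<longleftrightarrow> t = 0" for t
    using v[of t] q_ge_2 by (auto split: if_splits)
  then have "{t \<in> K. level a 0 t = q} = {0}" using K_0 by auto
  moreover have "{t \<in> K. level a 0 t = 2 * q} = ?A" "{t \<in> K. level a 0 t = 0} = ?B"
    using level_degenerate_zero q_ge_2 by auto
  moreover have "{t \<in> K. level a 0 t = n} = {}" if "n \<noteq> q" "n \<noteq> 2 * q" "n \<noteq> 0"
  proof -
    have "level a 0 t \<noteq> n" for t using v[of t] that by (auto split: if_splits)
    then show ?thesis by simp
  qed
  ultimately have "card {t \<in> K. level a 0 t = n} =
      (if n = q then 1 else if n = 2 * q then card ?A else if n = 0 then card ?B else 0)"
    by simp
  then show ?thesis unfolding card_level_shift[OF assms] using A B q_ge_2 by auto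
qed

text \<open>A kernel element \<open>k\<close> pairs nontrivially with \<open>b\<close> by
  \<open>range_adj\<close>. Translation along its \<open>K\<close>-multiples fixes
  \<open>qform a\<close> and moves the linear term through all of \<open>K\<close>, so it carries
  any fibre into any other.\<close>

lemma level_degenerate_not_range:
  assumes "b \<notin> range (adj a)" "t \<in> K"
  shows "level a b t = q"
proof -
  have "\<not> {x. adj a x = 0} \<subseteq> {0}"
    using card_mono[of "{0}" "{x. adj a x = 0}"] card_kernel q_ge_2 by auto
  then obtain k where k: "adj a k = 0" "k \<noteq> 0" by blast
  have qk: "qform a k = 0" using qform_eq_iff[of k 0] k by (simp add: adj_def)
  have "tr (b * k) \<noteq> 0" using assms(1) range_adj[OF k] by (simp add: mult.commute)
  have le: "level a b s \<le> level a b s'" if s: "s \<in> K" "s' \<in> K" for s s'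
  proof -
    \<comment> \<open>Chosen so that translation by \<open>l * k\<close> lowers the value by
      \<open>s - s'\<close>.\<close>
    define l where "l = (s - s') / tr (b * k)"
    have lK: "l \<in> K" unfolding l_def using s by (intro K_divide K_diff tr_in_K)
    have ql: "qform a (l * k) = 0" "adj a (l * k) = 0"
    proof -
      have "adj a (l * k) = l * adj a k" using lK by (simp add: adj_def K_def frob_simps algebra_simps)
      then show "adj a (l * k) = 0" using k by simp
      then show "qform a (l * k) = 0" using qform_eq_iff[of "l * k" 0] by (simp add: adj_def)
    qed
    have "tr (b * (l * k)) = s - s'"
      using tr_scale[OF lK, of "b * k"] \<open>tr (b * k) \<noteq> 0\<close> by (simp add: l_def ac_simps)
    then have "qform a (x + l * k) - tr (b * (x + l * k)) = qform a x - tr (b * x) - (s - s')" for x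
      using ql tr_adj_sym[of a x "l * k"] by (simp add: qform_add tr_add distrib_left)
    then have "(\<lambda>x. x + l * k) ` {x. qform a x - tr (b * x) = s} \<subseteq> {x. qform a x - tr (b * x) = s'}"
      by auto
    then show ?thesis unfolding level_def by (intro card_inj_on_le[of "\<lambda>x. x + l * k"]) auto
  qed
  have "q ^ 2 = (\<Sum>s\<in>K. level a b s)" by (rule sum_level[symmetric])
  also have "\<dots> = (\<Sum>s\<in>K. level a b t)" using le assms(2) by (intro sum.cong refl) (meson antisym)
  finally show ?thesis using card_K q_ge_2 by (simp add: power2_eq_square)
qed

lemma card_level_degenerate_not_range:
  assumes "b \<notin> range (adj a)"
  shows "card {t \<in> K. level a b t = n} = q * of_bool (n = q)"
proof -
  have "{t \<in> K. level a b t = n} = (if n = q then K else {})"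
    using level_degenerate_not_range[OF assms] by auto
  then show ?thesis using card_K by simp
qed

end

section \<open>Classifying and counting the coefficients \<open>a\<close>\<close>

definition elliptics :: "'a set" where
  "elliptics = {a. a \<noteq> 0 \<and> \<not> degenerate a \<and> level a 0 0 = 1}"

definition hyperbolics :: "'a set" where
  "hyperbolics = {a. a \<noteq> 0 \<and> \<not> degenerate a \<and> level a 0 0 = 2 * q - 1}"

definition degenerates :: "'a set" where
  "degenerates = {a. degenerate a}"

lemma coefficient_partition: "UNIV - {0} = elliptics \<union> hyperbolics \<union> degenerates"
proof -
  have "a \<noteq> 0 \<longleftrightarrow> a \<in> elliptics \<union> hyperbolics \<union> degenerates" for a
    using level_zero_cases[of a] degenerate_nonzero(1)[of a]
    unfolding elliptics_def hyperbolics_def degenerates_def by blast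
  then show ?thesis by blast
qed

lemma sum_coefficients:
  "(\<Sum>a\<in>UNIV - {0}. f a) = (\<Sum>a\<in>elliptics. f a) + (\<Sum>a\<in>hyperbolics. f a) + (\<Sum>a\<in>degenerates. f a)"
  for f :: "'a \<Rightarrow> 'b::comm_monoid_add"
proof -
  have "elliptics \<inter> hyperbolics = {}" "(elliptics \<union> hyperbolics) \<inter> degenerates = {}"
    using q_ge_2 by (auto simp: elliptics_def hyperbolics_def degenerates_def)
  then show ?thesis unfolding coefficient_partition by (simp add: sum.union_disjoint)
qed

text \<open>For odd \<open>q\<close>, doubling maps these coefficients bijectively onto the elements
  of norm 1; for even \<open>q\<close>, \<open>2 = 0\<close> rules them out.\<close>

lemma card_degenerates: "card degenerates = (if odd q then q + 1 else 0)"
proof (cases "odd q")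
  case True
  then have two: "(2 :: 'a) \<noteq> 0" using two_eq_0_iff by simp
  have "(2 :: 'a) * 2 \<noteq> 0" using two by (metis mult_eq_0_iff)
  then have four: "(4 :: 'a) \<noteq> 0" by simp
  have "bij_betw (\<lambda>x. 2 * x) degenerates {x. x ^ (q + 1) = 1}"
    by (rule bij_betwI[of _ _ _ "\<lambda>x. x / 2"])
      (use two four in \<open>auto simp: degenerates_def degenerate_def frob_simps ac_simps\<close>)
  then show ?thesis using card_norm_fibre[of 1] True by (simp add: bij_betw_same_card K_def)
next
  case False
  then have "degenerates = {}" using degenerate_nonzero(2) two_eq_0_iff by (auto simp: degenerates_def)
  with False show ?thesis by simp
qed

text \<open>Double counting of the pairs \<open>(a, x)\<close> with \<open>x \<noteq> 0\<close> and \<open>qform a x = 0\<close>.\<close>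

lemma card_hyperbolics: "2 * card hyperbolics + card degenerates = q * (q + 1)"
proof -
  let ?P = "{(x, a). x \<noteq> 0 \<and> qform a x = 0}"
  \<comment> \<open>For fixed nonzero \<open>x\<close> the condition is a trace equation in
    \<open>a\<close>.\<close>
  have 1: "card {a. x \<noteq> 0 \<and> qform a x = 0} = (if x = 0 then 0 else q)" for x
  proof (cases "x = 0")
    case False
    then have "{a. x \<noteq> 0 \<and> qform a x = 0} = {a. tr (x ^ 2 * a) = x ^ (q + 1)}"
      by (auto simp: qform_def mult.commute)
    then show ?thesis using card_linear_eq[of "x ^ 2" "x ^ (q + 1)"] False norm_in_K by simp
  qed simp
  have "card ?P = (\<Sum>x\<in>UNIV. card {a. x \<noteq> 0 \<and> qform a x = 0})"
    by (rule card_pair_set)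
  also have "\<dots> = (\<Sum>x\<in>UNIV - {0 :: 'a}. q)"
    by (simp only: 1, rule sum.mono_neutral_cong_right) auto
  also have "\<dots> = (q - 1) * (q + 1) * q" using card_units by simp
  finally have c1: "card ?P = (q - 1) * (q * (q + 1))" by (simp only: ac_simps)
  have "card ?P = card {(a, x). x \<noteq> 0 \<and> qform a x = 0}"
    by (rule bij_betw_same_card[of prod.swap], rule bij_betwI[of _ _ _ prod.swap]) auto
  also have "\<dots> = (\<Sum>a\<in>UNIV. card {x. x \<noteq> 0 \<and> qform a x = 0})"
    by (rule card_pair_set)
  also have "\<dots> = (\<Sum>a\<in>UNIV. level a 0 0 - 1)"
  proof (rule sum.cong[OF refl])
    fix a
    have "{x. qform a x = 0} = insert 0 {x. x \<noteq> 0 \<and> qform a x = 0}" by auto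
    then have "card {x. qform a x = 0} = Suc (card {x. x \<noteq> 0 \<and> qform a x = 0})" by simp
    then show "card {x. x \<noteq> 0 \<and> qform a x = 0} = level a 0 0 - 1" by (simp add: level_def)
  qed
  \<comment> \<open>\<open>qform 0 x\<close> is the norm of \<open>x\<close> and vanishes only at 0,
    so \<open>a = 0\<close> contributes nothing.\<close>
  also have "\<dots> = (\<Sum>a\<in>UNIV - {0}. level a 0 0 - 1)"
  proof -
    have "level 0 0 0 = card {0 :: 'a}"
      unfolding level_def by (rule arg_cong[where f = card]) (auto simp: qform_def)
    then show ?thesis by (simp add: sum.remove[of UNIV "0 :: 'a"])
  qed
  also have "\<dots> = (\<Sum>a\<in>elliptics. 0) + (\<Sum>a\<in>hyperbolics. 2 * (q - 1)) + (\<Sum>a\<in>degenerates. q - 1)"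
    unfolding sum_coefficients
    by (intro arg_cong2[where f = "(+)"] sum.cong refl)
      (auto simp: elliptics_def hyperbolics_def degenerates_def level_degenerate_zero)
  finally have "(q - 1) * (2 * card hyperbolics + card degenerates) = (q - 1) * (q * (q + 1))"
    using c1 by (simp add: algebra_simps)
  then show ?thesis using q_ge_2 by simp
qed

lemma card_elliptics: "card elliptics + card hyperbolics + card degenerates = (q - 1) * (q + 1)"
proof -
  have "card (UNIV - {0 :: 'a}) = card elliptics + card hyperbolics + card degenerates"
    unfolding card_eq_sum by (rule sum_coefficients)
  then show ?thesis using card_units by simp
qed

section \<open>Counting the parabolas\<close>

lemma num_parabolas_eq_sum:
  "num_parabolas TYPE('a) q n =
    q * (\<Sum>a\<in>UNIV - {0}. \<Sum>b\<in>UNIV. card {t \<in> K. level a b t = n})"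
proof -
  let ?T = "SIGMA a:UNIV - {0}. SIGMA b:UNIV. {c. level a b (tr c) = n}"
  let ?f = "\<lambda>(a, b, c). parabola a b (c :: 'a)"
  have "q ^ 2 \<ge> 2 ^ 2" using q_ge_2 by (rule power_mono) simp
  then have "CARD('a) > 2" using card_field by simp
  then have inj: "inj_on ?f ?T" by (auto simp: inj_on_def dest: parabola_inject)
  have "{C \<in> (parabolas :: ('a \<times> 'a) set set). planar_intersection q C = n} = ?f ` ?T"
    by (force simp: parabolas_def planar_intersection_parabola)
  then have "num_parabolas TYPE('a) q n = card ?T"
    unfolding num_parabolas_def using inj by (simp add: card_image)
  also have "\<dots> = (\<Sum>a\<in>UNIV - {0}. \<Sum>b\<in>UNIV. card {c. level a b (tr c) = n})"
    by simp
  \<comment> \<open>Every \<open>t\<close> in \<open>K\<close> is the trace of exactly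
    \<open>q\<close> coefficients \<open>c\<close>.\<close>
  also have "\<dots> = (\<Sum>a\<in>UNIV - {0}. \<Sum>b\<in>UNIV. q * card {t \<in> K. level a b t = n})"
  proof (intro sum.cong refl)
    fix a b
    have "card {c. level a b (tr c) = n} =
        (\<Sum>t\<in>{t \<in> K. level a b t = n}. card {c \<in> {c. level a b (tr c) = n}. tr c = t})"
      by (rule card_eq_sum_fibres) (auto simp: tr_in_K)
    also have "\<dots> = (\<Sum>t\<in>{t \<in> K. level a b t = n}. q)"
    proof (rule sum.cong[OF refl])
      fix t assume t: "t \<in> {t \<in> K. level a b t = n}"
      then have "{c \<in> {c. level a b (tr c) = n}. tr c = t} = {c. tr c = t}" by auto
      then show "card {c \<in> {c. level a b (tr c) = n}. tr c = t} = q" using t card_tr_fibre by simp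
    qed
    finally show "card {c. level a b (tr c) = n} = q * card {t \<in> K. level a b t = n}" by simp
  qed
  finally show ?thesis by (simp add: sum_distrib_left)
qed

text \<open>One summand for each class of \<open>a\<close>. In the degenerate class,
  \<open>q\<close> values of \<open>b\<close> lie in the range of \<open>adj a\<close> and
  \<open>q ^ 2 - q\<close> do not. The indicators add up correctly when listed values
  coincide.\<close>

lemma num_parabolas_formula:
  "real (num_parabolas TYPE('a) q n) = real q *
    (real (card elliptics) * real q ^ 2 * (of_bool (n = 1) + (real q - 1) * of_bool (n = q + 1))
     + real (card hyperbolics) * real q ^ 2
       * (of_bool (n = 2 * q - 1) + (real q - 1) * of_bool (n = q - 1))
     + real (card degenerates) * (real q * (of_bool (n = q)
           + (real q - 1) / 2 * (of_bool (n = 0) + of_bool (n = 2 * q)))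
         + (real q ^ 2 - real q) * real q * of_bool (n = q)))"
proof -
  let ?V = "\<lambda>a b. real (card {t \<in> K. level a b t = n})"
  have q1: "real (q - Suc 0) = real q - 1" using q_ge_2 by (simp add: of_nat_diff)
  have E: "(\<Sum>b\<in>UNIV. ?V a b) = real q ^ 2 * (of_bool (n = 1) + (real q - 1) * of_bool (n = q + 1))"
    if "a \<in> elliptics" for a
    using that by (simp add: elliptics_def card_level_elliptic card_field q1)
  have H: "(\<Sum>b\<in>UNIV. ?V a b)
      = real q ^ 2 * (of_bool (n = 2 * q - 1) + (real q - 1) * of_bool (n = q - 1))"
    if "a \<in> hyperbolics" for a
    using that by (simp add: hyperbolics_def card_level_hyperbolic card_field q1)
  have D: "(\<Sum>b\<in>UNIV. ?V a b) = real q * (of_bool (n = q)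
           + (real q - 1) / 2 * (of_bool (n = 0) + of_bool (n = 2 * q)))
         + (real q ^ 2 - real q) * real q * of_bool (n = q)"
    if "a \<in> degenerates" for a
  proof -
    have d: "degenerate a" using that by (simp add: degenerates_def)
    let ?R = "range (adj a)"
    have "(\<Sum>b\<in>UNIV. ?V a b) = (\<Sum>b\<in>?R. ?V a b) + (\<Sum>b\<in>UNIV - ?R. ?V a b)"
      by (subst sum.subset_diff[of ?R]) (auto simp: add.commute)
    also have "(\<Sum>b\<in>?R. ?V a b) = (\<Sum>b\<in>?R. of_bool (n = q)
           + (real q - 1) / 2 * (of_bool (n = 0) + of_bool (n = 2 * q)))"
    proof (rule sum.cong[OF refl])
      fix b assume "b \<in> ?R"
      from arg_cong[OF card_level_degenerate_range[OF d this, of n], of real]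
      show "?V a b = of_bool (n = q)
           + (real q - 1) / 2 * (of_bool (n = 0) + of_bool (n = 2 * q))"
        using q1 by simp
    qed
    also have "(\<Sum>b\<in>UNIV - ?R. ?V a b) = (\<Sum>b\<in>UNIV - ?R. real q * of_bool (n = q))"
      by (rule sum.cong[OF refl]) (simp add: card_level_degenerate_not_range[OF d])
    finally have sum: "(\<Sum>b\<in>UNIV. ?V a b) = (\<Sum>b\<in>?R. of_bool (n = q)
           + (real q - 1) / 2 * (of_bool (n = 0) + of_bool (n = 2 * q)))
         + (\<Sum>b\<in>UNIV - ?R. real q * of_bool (n = q))" .
    have "real (card (UNIV - ?R)) = real q ^ 2 - real q"
    proof -
      have "card (UNIV - ?R) = q ^ 2 - q"
        by (subst card_Diff_subset) (auto simp: card_field card_range_adj[OF d])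
      moreover have "q \<le> q ^ 2" by (simp add: power2_eq_square)
      ultimately show ?thesis by (simp add: of_nat_diff)
    qed
    then show ?thesis unfolding sum by (simp add: card_range_adj[OF d])
  qed
  have "real (num_parabolas TYPE('a) q n) = real q * (\<Sum>a\<in>UNIV - {0}. \<Sum>b\<in>UNIV. ?V a b)"
    unfolding num_parabolas_eq_sum by simp
  then show ?thesis unfolding sum_coefficients by (simp add: E H D ac_simps)
qed

lemma planar_intersection_image:
  assumes "\<And>n. n \<notin> S \<Longrightarrow> num_parabolas TYPE('a) q n = 0"
  shows "planar_intersection q ` (parabolas :: ('a \<times> 'a) set set) \<subseteq> S"
proof
  fix n assume "n \<in> planar_intersection q ` (parabolas :: ('a \<times> 'a) set set)"
  then have "num_parabolas TYPE('a) q n \<noteq> 0" (is ?nz)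
    unfolding num_parabolas_def by (auto simp: card_eq_0_iff)
  show "n \<in> S"
  proof (rule ccontr)
    assume "n \<notin> S"
    with \<open>?nz\<close> assms[of n] show False by simp
  qed
qed

end

theorem theoremA:
  fixes q :: nat
  assumes q: "primepow q"
    and card: "CARD('a::finite_field) = q ^ 2"
  shows
    "(odd q \<longrightarrow>
       planar_intersection q ` (parabolas :: ('a \<times> 'a) set set)
         \<subseteq> {0, 1, q - 1, q, q + 1, 2 * q - 1, 2 * q} \<and>
       real (num_parabolas TYPE('a) q 0)
         = real q ^ 2 * (real q + 1) * ((real q - 1) / 2) \<and>
       real (num_parabolas TYPE('a) q 1)
         = real q ^ 2 * (real q + 1) * (real q * (real q - 3) / 2) \<and>
       real (num_parabolas TYPE('a) q (q - 1))
         = real q ^ 2 * (real q + 1) * (real q * (real q - 1) ^ 2 / 2) \<and>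
       real (num_parabolas TYPE('a) q q)
         = real q ^ 2 * (real q + 1) * (real q ^ 2 - real q + 1) \<and>
       real (num_parabolas TYPE('a) q (q + 1))
         = real q ^ 2 * (real q + 1) * (real q * (real q - 1) * (real q - 3) / 2) \<and>
       real (num_parabolas TYPE('a) q (2 * q - 1))
         = real q ^ 2 * (real q + 1) * (real q * (real q - 1) / 2) \<and>
       real (num_parabolas TYPE('a) q (2 * q))
         = real q ^ 2 * (real q + 1) * ((real q - 1) / 2)) \<and>
     (even q \<longrightarrow>
       planar_intersection q ` (parabolas :: ('a \<times> 'a) set set)
         \<subseteq> {1, q - 1, q + 1, 2 * q - 1} \<and>
       (q \<noteq> 2 \<longrightarrow>
         real (num_parabolas TYPE('a) q 1)
           = real q ^ 3 * (real q + 1) * (real q / 2 - 1) \<and>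
         real (num_parabolas TYPE('a) q (q - 1))
           = real q ^ 3 * (real q + 1) * (real q - 1) * (real q / 2) \<and>
         real (num_parabolas TYPE('a) q (q + 1))
           = real q ^ 3 * (real q + 1) * (real q - 1) * (real q / 2 - 1) \<and>
         real (num_parabolas TYPE('a) q (2 * q - 1))
           = real q ^ 3 * (real q + 1) * (real q / 2)) \<and>
       \<comment> \<open>for \<open>q = 2\<close> the listed values coincide in pairs, and so their counts add up\<close>
       (q = 2 \<longrightarrow>
         real (num_parabolas TYPE('a) q 1)
           = real q ^ 3 * (real q + 1) * (real q / 2 - 1)
             + real q ^ 3 * (real q + 1) * (real q - 1) * (real q / 2) \<and>
         real (num_parabolas TYPE('a) q 3)
           = real q ^ 3 * (real q + 1) * (real q - 1) * (real q / 2 - 1)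
             + real q ^ 3 * (real q + 1) * (real q / 2)))"
proof -
  interpret hermitian_field q "TYPE('a)" using q card by unfold_locales
  have q2: "q \<ge> 2" by (rule q_ge_2)
  define e h d where "e = real (card elliptics)" and "h = real (card hyperbolics)"
    and "d = real (card degenerates)"
  \<comment> \<open>Together with \<open>card_degenerates\<close>, the next two relations determine
    \<open>h\<close> and then \<open>e\<close>.\<close>
  have hd: "2 * h + d = real q * (real q + 1)"
    unfolding h_def d_def using arg_cong[OF card_hyperbolics, of real]
    by (simp add: algebra_simps)
  have ehd: "e + h + d = (real q - 1) * (real q + 1)"
    unfolding e_def h_def d_def using arg_cong[OF card_elliptics, of real] q2
    by (simp add: of_nat_diff algebra_simps)
  note num = num_parabolas_formula[folded e_def h_def d_def]
  show ?thesis (is "(_ \<longrightarrow> ?Odd) \<and> (_ \<longrightarrow> ?Even)")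
  proof (rule conjI; rule impI)
    assume "odd q"
    then have d: "d = real q + 1" by (simp add: d_def card_degenerates)
    then have h: "h = (real q + 1) * (real q - 1) / 2" using hd by (simp add: algebra_simps)
    have e: "e = (real q + 1) * (real q - 3) / 2" using ehd unfolding d h by (simp add: field_simps)
    \<comment> \<open>This form resolves the truncated subtractions \<open>q - 1\<close> and
      \<open>2 * q - 1\<close> and decides all indicators.\<close>
    obtain m where m: "q = m + 3"
      using q2 \<open>odd q\<close> by (metis One_nat_def add.commute le_Suc_ex le_antisym not_less_eq_eq numeral_2_eq_2 numeral_3_eq_3 even_numeral)
    have num0: "num_parabolas TYPE('a) q n = 0" if "n \<notin> {0, 1, q - 1, q, q + 1, 2 * q - 1, 2 * q}" for n
      using num[of n] that by simp
    show ?Odd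
      by (intro conjI planar_intersection_image num0, assumption;
        unfold num e h d; simp add: m field_simps power2_eq_square)
  next
    assume "even q"
    then have d: "d = 0" by (simp add: d_def card_degenerates)
    then have h: "h = real q * (real q + 1) / 2" using hd by simp
    then have e: "e = (real q + 1) * (real q / 2 - 1)" using ehd d by (simp add: field_simps)
    have num0: "num_parabolas TYPE('a) q n = 0" if "n \<notin> {1, q - 1, q + 1, 2 * q - 1}" for n
      using num[of n] that d by simp
    then have sub: "planar_intersection q ` (parabolas :: ('a \<times> 'a) set set)
        \<subseteq> {1, q - 1, q + 1, 2 * q - 1}"
      by (rule planar_intersection_image)
    show ?Even
    \<comment> \<open>Only here do listed values coincide: \<open>q - 1 = 1\<close> and
      \<open>q + 1 = 2 * q - 1\<close>.\<close>
    proof (cases "q = 2")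
      case True
      then show ?thesis
        by (intro conjI impI sub; unfold num e h d; simp)
    next
      case False
      then obtain m where m: "q = m + 3"
        using q2 by (metis add.commute le_Suc_ex le_antisym not_less_eq_eq numeral_2_eq_2 numeral_3_eq_3)
      show ?thesis
        by (intro conjI impI sub; unfold num e h d;
          simp add: m field_simps power2_eq_square power3_eq_cube)
    qed
  qed
qed

end
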